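(* $$\mathsf{IPspace}=\bigcap_{\varrho\in\mathbb{R}}\mathsf{NORM}_\varrho .$$ That is, a real normed vector space is an inner product space (its norm is induced by an inner product) if and only if it has the angle $\angle_\varrho$ for every real number $\varrho$.
   Context: Let $(X,\|\cdot\|)$ be a real normed vector space and $\varrho\in\mathbb{R}$. For $\vec x,\vec y\in X\setminus\{\vec 0\}$ put $\mathbf{s}=\left\|\frac{\vec x}{\|\vec x\|}+\frac{\vec y}{\|\vec y\|}\right\|$, $\mathbf{d}=\left\|\frac{\vec x}{\|\vec x\|}-\frac{\vec y}{\|\vec y\|}\right\|$, $\mathbf{\Sigma}=\mathbf{s}^2+\mathbf{d}^2$ (which is $>0$), $\mathbf{\Delta}=\mathbf{s}^2-\mathbf{d}^2$, and $\langle\vec x\,|\,\vec y\rangle_\varrho=\|\vec x\|\cdot\|\vec y\|\cdot\frac14\mathbf{\Delta}\cdot\left(\frac14\mathbf{\Sigma}\right)^{\varrho}$; put $\langle\vec x\,|\,\vec y\rangle_\varrho=0$ if $\vec x=\vec 0$ or $\vec y=\vec 0$. The space $(X,\|\cdot\|)$ "has the angle $\angle_\varrho$" if $|\langle\vec x\,|\,\vec y\rangle_\varrho|\le\|\vec x\|\cdot\|\vec y\|$ for all $\vec x,\vec y\in X$, i.e. if the angle $\angle_\varrho(\vec x,\vec y):=\arccos\frac{\langle\vec x|\vec y\rangle_\varrho}{\|\vec x\|\|\vec y\|}$ is defined for all $\vec x,\vec y\ne\vec 0$. $\mathsf{NORM}_\varrho$ is the class of all real normed vector spaces that have the angle $\angle_\varrho$;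 $\mathsf{IPspace}$ is the class of all real inner product spaces (of any dimension, not necessarily complete), regarded as normed spaces. *)

theory Defs
  imports "HOL-Analysis.Analysis"
begin

text \<open>
  A normed space is given by a type of class \<open>real_normed_vector\<close>; a property of the
  space is a predicate on the type, taking an argument of type \<open>'a itself\<close>.
\<close>

definition is_inner_product :: "('a::real_vector \<Rightarrow> 'a \<Rightarrow> real) \<Rightarrow> bool" where
  "is_inner_product B \<longleftrightarrow>
     bilinear B \<and> (\<forall>x y. B x y = B y x) \<and> (\<forall>x. x \<noteq> 0 \<longrightarrow> B x x > 0)"

definition IPspace :: "'a::real_normed_vector itself \<Rightarrow> bool" where
  "IPspace _ \<longleftrightarrow> (\<exists>B :: 'a \<Rightarrow> 'a \<Rightarrow> real. is_inner_product B \<and> (\<forall>x. norm x = sqrt (B x x)))"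

definition unit_sum_norm :: "'a::real_normed_vector \<Rightarrow> 'a \<Rightarrow> real" where
  "unit_sum_norm x y = norm (x /\<^sub>R norm x + y /\<^sub>R norm y)"

definition unit_diff_norm :: "'a::real_normed_vector \<Rightarrow> 'a \<Rightarrow> real" where
  "unit_diff_norm x y = norm (x /\<^sub>R norm x - y /\<^sub>R norm y)"

definition Sigma_sq :: "'a::real_normed_vector \<Rightarrow> 'a \<Rightarrow> real" where
  "Sigma_sq x y = (unit_sum_norm x y)\<^sup>2 + (unit_diff_norm x y)\<^sup>2"

definition Delta_sq :: "'a::real_normed_vector \<Rightarrow> 'a \<Rightarrow> real" where
  "Delta_sq x y = (unit_sum_norm x y)\<^sup>2 - (unit_diff_norm x y)\<^sup>2"

definition rho_product :: "real \<Rightarrow> 'a::real_normed_vector \<Rightarrow> 'a \<Rightarrow> real" where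
  "rho_product \<rho> x y =
     (if x = 0 \<or> y = 0 then 0
      else norm x * norm y * (1/4 * Delta_sq x y) * (1/4 * Sigma_sq x y) powr \<rho>)"

text \<open>
  By the following lemma \<open>powr\<close> is only applied to a positive base in \<open>rho_product\<close>, so it
  is the usual real power there.
\<close>

lemma Sigma_sq_pos:
  fixes x y :: "'a::real_normed_vector"
  assumes "x \<noteq> 0" "y \<noteq> 0"
  shows "Sigma_sq x y > 0"
proof (rule ccontr)
  define u where "u = x /\<^sub>R norm x"
  define v where "v = y /\<^sub>R norm y"
  assume "\<not> Sigma_sq x y > 0"
  then have "(norm (u + v))\<^sup>2 + (norm (u - v))\<^sup>2 \<le> 0"
    by (simp add: Sigma_sq_def unit_sum_norm_def unit_diff_norm_def u_def v_def)
  then have "u + v = 0" "u - v = 0"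
    unfolding sum_power2_le_zero_iff norm_eq_zero by blast+
  then have "(u + v) + (u - v) = 0" by simp
  then have "2 *\<^sub>R u = 0" by (simp add: scaleR_2)
  then show False
    using assms by (simp add: u_def)
qed

text \<open>
  The defining inequality says that the argument of \<open>arccos\<close> in the angle lies in \<open>[-1, 1]\<close>
  for all nonzero vectors. It is used because \<open>arccos\<close> is a total function in HOL.
\<close>

definition has_angle :: "real \<Rightarrow> 'a::real_normed_vector itself \<Rightarrow> bool" where
  "has_angle \<rho> _ \<longleftrightarrow> (\<forall>x y :: 'a. \<bar>rho_product \<rho> x y\<bar> \<le> norm x * norm y)"

text \<open>
  For a type of class \<open>real_inner\<close> the norm comes from an inner product in the sense above.
\<close>

lemma IPspace_real_inner: "IPspace TYPE('a::real_inner)"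
  unfolding IPspace_def is_inner_product_def
proof (intro exI[of _ inner] conjI allI impI)
  show "bilinear (inner :: 'a \<Rightarrow> 'a \<Rightarrow> real)"
    by (simp add: bilinear_def linear_iff inner_add_left inner_add_right)
qed (auto simp: inner_commute norm_eq_sqrt_inner)

end

theory Submission
  imports Defs
begin

text \<open>
  In an inner product space the parallelogram law gives \<open>\<Sigma> = 4\<close>, so the factor \<open>(\<Sigma>/4)\<^sup>\<rho>\<close> is \<open>1\<close> and
  the bound on the product is independent of \<open>\<rho>\<close>.
  
  For the converse, let \<open>c = |\<Delta>|/4\<close> and \<open>\<sigma> = \<Sigma>/4\<close>. If \<open>c \<sigma>\<^sup>\<rho> \<le> 1\<close> for all real \<open>\<rho>\<close>, then \<open>c = 0\<close>
  or \<open>\<sigma> = 1\<close>, because the powers of \<open>\<sigma> \<noteq> 1\<close> are unbounded. Hence two unit vectors either have a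
  sum and a difference of equal norm (they are isosceles orthogonal) or satisfy the rhombus law
  \<open>s\<^sup>2 + d\<^sup>2 = 4\<close>. Two steps lead from this dichotomy to an inner product.
  
  The dichotomy says nothing about an isosceles orthogonal pair of unit vectors \<open>p, q\<close>. But such a
  pair is a limit of isosceles orthogonal pairs \<open>P, Q\<close> of different norms, found by the intermediate
  value theorem (lemma \<open>wider_isosceles_pair\<close>). Applied to \<open>P + Q\<close> and \<open>P - Q\<close>, which have
  equal norms, the dichotomy gives the Pythagorean theorem for \<open>P, Q\<close>, and the limit gives it for
  \<open>p, q\<close>. So the rhombus law holds for all unit vectors (lemma \<open>unit_rhombus_law_if_dichotomy\<close>).
  
  That the rhombus law implies an inner product is a theorem of M. M. Day. In a plane, choose an isosceles orthogonal pair of unit vectors and let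
  \<open>|.|\<close> be the Euclidean norm that makes them orthonormal. Both norms agree in the directions at
  multiples of \<open>45\<close> degrees. If they agree in two directions and in the two directions perpendicular
  to these, then two instances of the rhombus law form a linear system that forces them to agree
  along the bisector (lemma \<open>contact_bisection\<close>). So they agree on a dense set of directions, hence
  everywhere, and \<open>norm\<^sup>2\<close> is a quadratic form on every plane. Polarization then yields the inner
  product.
\<close>

section \<open>Inner product spaces have every angle\<close>

lemma IPspace_parallelogram_law:
  fixes x y :: "'a::real_normed_vector"
  assumes "IPspace TYPE('a)"
  shows "(norm (x + y))\<^sup>2 + (norm (x - y))\<^sup>2 = 2 * (norm x)\<^sup>2 + 2 * (norm y)\<^sup>2"
proof -
  obtain B :: "'a \<Rightarrow> 'a \<Rightarrow> real"
    where B: "is_inner_product B" and N: "\<And>z. norm z = sqrt (B z z)"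
    using assms unfolding IPspace_def by blast
  have bil: "bilinear B" using B by (simp add: is_inner_product_def)
  have nonneg: "B z z \<ge> 0" for z
    using N[of z] norm_ge_zero[of z] by (simp add: real_sqrt_ge_0_iff)
  have sq: "(norm z)\<^sup>2 = B z z" for z
    using nonneg[of z] by (simp add: N)
  show ?thesis
    by (simp add: sq bilinear_ladd[OF bil] bilinear_radd[OF bil]
        bilinear_lsub[OF bil] bilinear_rsub[OF bil])
qed

lemma IPspace_has_angle:
  assumes "IPspace TYPE('a::real_normed_vector)"
  shows "has_angle \<rho> TYPE('a)"
  unfolding has_angle_def
proof (intro allI)
  fix x y :: 'a
  show "\<bar>rho_product \<rho> x y\<bar> \<le> norm x * norm y"
  proof (cases "x = 0 \<or> y = 0")
    case False
    define s where "s = unit_sum_norm x y"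
    define d where "d = unit_diff_norm x y"
    have 4: "s\<^sup>2 + d\<^sup>2 = 4"
      using IPspace_parallelogram_law[OF assms, of "x /\<^sub>R norm x" "y /\<^sub>R norm y"] False
      by (simp add: s_def d_def unit_sum_norm_def unit_diff_norm_def)
    have "\<bar>s\<^sup>2 - d\<^sup>2\<bar> \<le> 4"
      using 4 zero_le_power2[of s] zero_le_power2[of d] by linarith
    then have "\<bar>1/4 * (s\<^sup>2 - d\<^sup>2)\<bar> \<le> 1" by simp
    then have "norm x * norm y * \<bar>1/4 * (s\<^sup>2 - d\<^sup>2)\<bar> \<le> norm x * norm y"
      by (intro mult_left_le) auto
    then show ?thesis
      using False 4 by (simp add: rho_product_def Sigma_sq_def Delta_sq_def
          flip: s_def d_def) (simp add: abs_mult)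
  qed (auto simp: rho_product_def)
qed

section \<open>The rhombus law\<close>

definition rhombus_dichotomy :: "'a::real_normed_vector itself \<Rightarrow> bool" where
  "rhombus_dichotomy _ \<longleftrightarrow> (\<forall>x y :: 'a. norm x = norm y \<longrightarrow>
     norm (x + y) = norm (x - y) \<or> (norm (x + y))\<^sup>2 + (norm (x - y))\<^sup>2 = 4 * (norm x)\<^sup>2)"

definition unit_rhombus_law :: "'a::real_normed_vector itself \<Rightarrow> bool" where
  "unit_rhombus_law _ \<longleftrightarrow> (\<forall>x y :: 'a. norm x = 1 \<longrightarrow> norm y = 1 \<longrightarrow>
     (norm (x + y))\<^sup>2 + (norm (x - y))\<^sup>2 = 4)"

text \<open>
  If \<open>\<Delta> \<noteq> 0\<close> and \<open>\<Sigma> \<noteq> 4\<close>, then \<open>(\<Sigma>/4)\<^sup>\<rho>\<close> takes every positive value as \<open>\<rho>\<close> varies, and a large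
  one violates the bound.
\<close>

lemma all_angles_rhombus_dichotomy:
  assumes angle: "\<And>\<rho>. has_angle \<rho> TYPE('a::real_normed_vector)"
  shows "rhombus_dichotomy TYPE('a)"
  unfolding rhombus_dichotomy_def
proof (intro allI impI)
  fix x y :: 'a
  assume eq: "norm x = norm y"
  show "norm (x + y) = norm (x - y) \<or> (norm (x + y))\<^sup>2 + (norm (x - y))\<^sup>2 = 4 * (norm x)\<^sup>2"
  proof (cases "x = 0")
    case True
    then show ?thesis by simp
  next
    case False
    define n where "n = norm x"
    have n: "n > 0" using False by (simp add: n_def)
    have y: "y \<noteq> 0" using False eq by auto
    define s where "s = norm (x + y)"
    define d where "d = norm (x - y)"
    have sum: "unit_sum_norm x y = s / n"
    proof -
      have "x /\<^sub>R norm x + y /\<^sub>R norm y = (x + y) /\<^sub>R n"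
        using eq by (simp add: n_def scaleR_add_right)
      then show ?thesis using n by (simp add: unit_sum_norm_def s_def divide_inverse)
    qed
    have diff: "unit_diff_norm x y = d / n"
    proof -
      have "x /\<^sub>R norm x - y /\<^sub>R norm y = (x - y) /\<^sub>R n"
        using eq by (simp add: n_def scaleR_diff_right)
      then show ?thesis using n by (simp add: unit_diff_norm_def d_def divide_inverse)
    qed
    define \<sigma> where "\<sigma> = 1/4 * Sigma_sq x y"
    define c where "c = \<bar>1/4 * Delta_sq x y\<bar>"
    have \<sigma>: "\<sigma> > 0" using Sigma_sq_pos[OF False y] by (simp add: \<sigma>_def)
    have bound: "c * \<sigma> powr \<rho> \<le> 1" for \<rho>
    proof -
      have "\<bar>rho_product \<rho> x y\<bar> \<le> norm x * norm y"
        using angle[of \<rho>] unfolding has_angle_def by blast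
      then have "norm x * norm y * (c * \<sigma> powr \<rho>) \<le> norm x * norm y"
        using False y by (simp add: rho_product_def abs_mult c_def \<sigma>_def)
      then show ?thesis using False y by (simp add: mult_le_cancel_left1 zero_less_mult_iff)
    qed
    have "c = 0 \<or> \<sigma> = 1"
    proof (rule ccontr)
      assume "\<not> ?thesis"
      then have c: "c > 0" and "\<sigma> \<noteq> 1" by (auto simp: c_def)
      \<comment> \<open>At this exponent the bounded quantity \<open>c * \<sigma> powr \<rho>\<close> is 2.\<close>
      then have "\<sigma> powr (log \<sigma> (2 / c)) = 2 / c" using \<sigma> by simp
      then show False using bound[of "log \<sigma> (2 / c)"] c by simp
    qed
    then show ?thesis
    proof
      assume "c = 0"
      then have "(s / n)\<^sup>2 = (d / n)\<^sup>2" by (simp add: c_def Delta_sq_def sum diff)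
      then have "s = d" using n
        by (simp add: power_divide) (simp add: s_def d_def power2_eq_iff_nonneg)
      then show ?thesis by (simp add: s_def d_def)
    next
      assume "\<sigma> = 1"
      then have "(s / n)\<^sup>2 + (d / n)\<^sup>2 = 4" by (simp add: \<sigma>_def Sigma_sq_def sum diff)
      then have "s\<^sup>2 + d\<^sup>2 = 4 * n\<^sup>2" using n by (simp add: power_divide field_simps)
      then show ?thesis by (simp add: s_def d_def n_def)
    qed
  qed
qed

text \<open>
  The vectors \<open>p + q\<close> and \<open>p - q\<close> have equal norms, so the dichotomy applies to them; their sum
  and difference are \<open>2p\<close> and \<open>2q\<close>, and \<open>norm p \<noteq> norm q\<close> excludes its first alternative.
\<close>

lemma isosceles_pythagoras:
  fixes p q :: "'a::real_normed_vector"
  assumes dich: "rhombus_dichotomy TYPE('a)"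
    and iso: "norm (p + q) = norm (p - q)" and neq: "norm p \<noteq> norm q"
  shows "(norm (p + q))\<^sup>2 = (norm p)\<^sup>2 + (norm q)\<^sup>2"
proof -
  have sum: "(p + q) + (p - q) = 2 *\<^sub>R p" and diff: "(p + q) - (p - q) = 2 *\<^sub>R q"
    by (simp_all add: scaleR_2)
  show ?thesis
    using dich[unfolded rhombus_dichotomy_def, rule_format, OF iso] neq
    unfolding sum diff by (simp add: power_mult_distrib)
qed

text \<open>
  The convex function \<open>t \<mapsto> norm (t p + q)\<close> takes the same value at \<open>-1\<close> and \<open>1\<close>, and this value
  exceeds its value \<open>1\<close> at \<open>0\<close>. So the function increases to the right of \<open>1\<close> and to the left of
  \<open>-1\<close>, and every higher level is attained at some \<open>1 + \<beta>\<close> and some \<open>-(1 + \<alpha>)\<close>. The slope on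
  the left is at least \<open>norm (p + q) - 1\<close> in absolute value and the slope on the right is at most
  \<open>1\<close>, which bounds \<open>\<alpha>\<close> by a multiple of \<open>\<beta>\<close>.
\<close>

lemma wider_isosceles_pair:
  fixes p q :: "'a::real_normed_vector"
  assumes p: "norm p = 1" and q: "norm q = 1"
    and iso: "norm (p + q) = norm (p - q)" and gt: "norm (p + q) > 1" and \<beta>: "\<beta> > 0"
  shows "\<exists>\<alpha>>0. norm ((1 + \<alpha>) *\<^sub>R p - q) = norm ((1 + \<beta>) *\<^sub>R p + q)
           \<and> \<alpha> * (norm (p + q) - 1) \<le> \<beta>"
proof -
  define s where "s = norm (p + q)"
  define K where "K t = norm ((1 + t) *\<^sub>R p - q)" for t
  define h where "h = norm ((1 + \<beta>) *\<^sub>R p + q)"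
  have s1: "s > 1" using gt by (simp add: s_def)
  have h_ge: "h \<ge> s + \<beta> * (s - 1)"
  proof -
    have "(1 + \<beta>) *\<^sub>R (p + q) = \<beta> *\<^sub>R q + ((1 + \<beta>) *\<^sub>R p + q)" by (simp add: algebra_simps)
    then have "norm ((1 + \<beta>) *\<^sub>R (p + q)) \<le> norm (\<beta> *\<^sub>R q) + h"
      unfolding h_def by (metis norm_triangle_ineq)
    then have "(1 + \<beta>) * s \<le> \<beta> + h" using \<beta> q by (simp add: s_def)
    then show ?thesis by (simp add: algebra_simps)
  qed
  then have h_gt: "h > s" using \<beta> s1 by (smt (verit) mult_pos_pos)
  have h_le: "h \<le> s + \<beta>"
  proof -
    have "(1 + \<beta>) *\<^sub>R p + q = (p + q) + \<beta> *\<^sub>R p" by (simp add: algebra_simps)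
    then have "h \<le> s + norm (\<beta> *\<^sub>R p)"
      unfolding h_def s_def by (metis norm_triangle_ineq)
    then show ?thesis using \<beta> p by simp
  qed
  have K0: "K 0 = s" using iso by (simp add: K_def s_def)
  have far: "K (2 + \<beta>) \<ge> h"
  proof -
    have "K (2 + \<beta>) \<ge> norm ((1 + (2 + \<beta>)) *\<^sub>R p) - norm q"
      unfolding K_def by (rule norm_triangle_ineq2)
    moreover have "h \<le> norm ((1 + \<beta>) *\<^sub>R p) + norm q"
      unfolding h_def by (rule norm_triangle_ineq)
    ultimately show ?thesis using p q \<beta> by simp
  qed
  have "\<exists>\<alpha>. 0 \<le> \<alpha> \<and> \<alpha> \<le> 2 + \<beta> \<and> K \<alpha> = h"
    using K0 h_gt far \<beta> by (intro IVT') (auto simp: K_def intro!: continuous_intros)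
  then obtain \<alpha> where \<alpha>: "0 \<le> \<alpha>" "K \<alpha> = h" by blast
  then have "\<alpha> > 0" using K0 h_gt by (cases "\<alpha> = 0") auto
  have "(1 + \<alpha>) *\<^sub>R (p - q) = ((1 + \<alpha>) *\<^sub>R p - q) - \<alpha> *\<^sub>R q" by (simp add: algebra_simps)
  then have "norm ((1 + \<alpha>) *\<^sub>R (p - q)) \<le> K \<alpha> + norm (\<alpha> *\<^sub>R q)"
    unfolding K_def by (metis norm_triangle_ineq4)
  then have "(1 + \<alpha>) * s \<le> h + \<alpha>"
    using \<alpha> q iso by (simp add: s_def)
  then have "s + \<alpha> * (s - 1) \<le> h" by (simp add: algebra_simps)
  with h_le have "\<alpha> * (s - 1) \<le> \<beta>" by simp
  with \<alpha> \<open>\<alpha> > 0\<close> show ?thesis by (auto simp: K_def h_def s_def)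
qed

text \<open>
  The points \<open>(1 + \<beta>) p + q\<close> and \<open>(1 + \<alpha>) p - q\<close> of equal norm are the sum and the difference
  of an isosceles orthogonal pair \<open>P, Q\<close> that tends to \<open>p, q\<close> as \<open>\<beta>\<close> tends to \<open>0\<close>. As \<open>P\<close> is
  lengthened by the mean of \<open>\<alpha>\<close> and \<open>\<beta>\<close>, and \<open>q\<close> is moved only by half of their difference,
  \<open>P\<close> is longer than \<open>Q\<close>. Hence Pythagoras holds for \<open>P, Q\<close> and, in the limit, for \<open>p, q\<close>.
\<close>

lemma isosceles_unit_pair_gt_1:
  fixes p q :: "'a::real_normed_vector"
  assumes dich: "rhombus_dichotomy TYPE('a)"
    and p: "norm p = 1" and q: "norm q = 1"
    and iso: "norm (p + q) = norm (p - q)" and gt: "norm (p + q) > 1"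
  shows "(norm (p + q))\<^sup>2 = 2"
proof -
  define s where "s = norm (p + q)"
  have s1: "s > 1" using gt by (simp add: s_def)
  obtain \<alpha> where \<alpha>: "\<And>\<beta>. \<beta> > 0 \<Longrightarrow> \<alpha> \<beta> > 0"
      "\<And>\<beta>. \<beta> > 0 \<Longrightarrow> norm ((1 + \<alpha> \<beta>) *\<^sub>R p - q) = norm ((1 + \<beta>) *\<^sub>R p + q)"
      "\<And>\<beta>. \<beta> > 0 \<Longrightarrow> \<alpha> \<beta> * (s - 1) \<le> \<beta>"
    using wider_isosceles_pair[OF p q iso gt] unfolding s_def by metis
  define P where "P \<beta> = ((2 + \<alpha> \<beta> + \<beta>) / 2) *\<^sub>R p" for \<beta>
  define Q where "Q \<beta> = q + ((\<beta> - \<alpha> \<beta>) / 2) *\<^sub>R p" for \<beta>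
  have PQ: "P \<beta> + Q \<beta> = (1 + \<beta>) *\<^sub>R p + q" "P \<beta> - Q \<beta> = (1 + \<alpha> \<beta>) *\<^sub>R p - q" for \<beta>
  proof -
    have *: "(2 + \<alpha> \<beta> + \<beta>) / 2 + (\<beta> - \<alpha> \<beta>) / 2 = 1 + \<beta>"
      "(2 + \<alpha> \<beta> + \<beta>) / 2 - (\<beta> - \<alpha> \<beta>) / 2 = 1 + \<alpha> \<beta>"
      by (simp_all add: field_simps)
    have "P \<beta> + Q \<beta> = ((2 + \<alpha> \<beta> + \<beta>) / 2 + (\<beta> - \<alpha> \<beta>) / 2) *\<^sub>R p + q"
      "P \<beta> - Q \<beta> = ((2 + \<alpha> \<beta> + \<beta>) / 2 - (\<beta> - \<alpha> \<beta>) / 2) *\<^sub>R p - q"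
      unfolding P_def Q_def scaleR_add_left scaleR_diff_left by simp_all
    then show "P \<beta> + Q \<beta> = (1 + \<beta>) *\<^sub>R p + q" "P \<beta> - Q \<beta> = (1 + \<alpha> \<beta>) *\<^sub>R p - q"
      unfolding * by simp_all
  qed
  have pyth: "(norm ((1 + \<beta>) *\<^sub>R p + q))\<^sup>2 = ((2 + \<alpha> \<beta> + \<beta>) / 2)\<^sup>2 + (norm (Q \<beta>))\<^sup>2"
    if "\<beta> > 0" for \<beta>
  proof -
    have nP: "norm (P \<beta>) = (2 + \<alpha> \<beta> + \<beta>) / 2" using \<alpha>(1)[OF that] that p by (simp add: P_def)
    have "norm (Q \<beta>) \<le> 1 + \<bar>(\<beta> - \<alpha> \<beta>) / 2\<bar>"
      unfolding Q_def using norm_triangle_ineq[of q "((\<beta> - \<alpha> \<beta>) / 2) *\<^sub>R p"] p q by simp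
    also have "\<dots> < norm (P \<beta>)"
    proof -
      have "\<bar>(\<beta> - \<alpha> \<beta>) / 2\<bar> < (\<alpha> \<beta> + \<beta>) / 2"
        unfolding abs_less_iff using \<alpha>(1)[OF that] that by (simp add: diff_divide_distrib)
      then show ?thesis by (simp add: nP)
    qed
    finally have "norm (P \<beta>) \<noteq> norm (Q \<beta>)" by simp
    moreover have "norm (P \<beta> + Q \<beta>) = norm (P \<beta> - Q \<beta>)" using \<alpha>(2)[OF that] by (simp add: PQ)
    ultimately have "(norm (P \<beta> + Q \<beta>))\<^sup>2 = (norm (P \<beta>))\<^sup>2 + (norm (Q \<beta>))\<^sup>2"
      using isosceles_pythagoras[OF dich] by blast
    then show ?thesis by (simp add: PQ nP)
  qed
  have id: "((\<lambda>\<beta>. \<beta>) \<longlongrightarrow> (0::real)) (at_right 0)" by (rule tendsto_ident_at)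
  have \<alpha>0: "(\<alpha> \<longlongrightarrow> 0) (at_right 0)"
  proof (rule tendsto_sandwich[of "\<lambda>_. 0" _ _ "\<lambda>\<beta>. \<beta> / (s - 1)"])
    show "((\<lambda>\<beta>. \<beta> / (s - 1)) \<longlongrightarrow> 0) (at_right 0)"
      using tendsto_divide[OF id tendsto_const, of "s - 1"] s1 by simp
    show "\<forall>\<^sub>F \<beta> in at_right 0. \<alpha> \<beta> \<le> \<beta> / (s - 1)"
      using eventually_at_right_less[of 0]
      by eventually_elim (use \<alpha>(3) s1 in \<open>simp add: pos_le_divide_eq\<close>)
    show "\<forall>\<^sub>F \<beta> in at_right 0. 0 \<le> \<alpha> \<beta>"
      using eventually_at_right_less[of 0]
      by eventually_elim (use \<alpha>(1) in \<open>simp add: less_imp_le\<close>)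
  qed simp
  have lhs: "((\<lambda>\<beta>. (norm ((1 + \<beta>) *\<^sub>R p + q))\<^sup>2) \<longlongrightarrow> (norm ((1 + 0) *\<^sub>R p + q))\<^sup>2) (at_right 0)"
    by (intro tendsto_intros)
  have rhs: "((\<lambda>\<beta>. ((2 + \<alpha> \<beta> + \<beta>) / 2)\<^sup>2 + (norm (Q \<beta>))\<^sup>2) \<longlongrightarrow>
      ((2 + 0 + 0) / 2)\<^sup>2 + (norm (q + ((0 - 0) / 2) *\<^sub>R p))\<^sup>2) (at_right 0)"
    unfolding Q_def by (intro tendsto_intros \<alpha>0) auto
  have "\<forall>\<^sub>F \<beta> in at_right 0.
      (norm ((1 + \<beta>) *\<^sub>R p + q))\<^sup>2 = ((2 + \<alpha> \<beta> + \<beta>) / 2)\<^sup>2 + (norm (Q \<beta>))\<^sup>2"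
    using eventually_at_right_less[of 0] by eventually_elim (rule pyth)
  note lhs_limit_rhs = tendsto_cong[OF this, THEN iffD1, OF lhs]
  have "(norm ((1 + 0) *\<^sub>R p + q))\<^sup>2
      = ((2 + 0 + 0) / 2)\<^sup>2 + (norm (q + ((0 - 0) / 2) *\<^sub>R p))\<^sup>2"
    by (rule tendsto_unique[OF trivial_limit_at_right_real lhs_limit_rhs rhs])
  then show ?thesis using q by simp
qed

text \<open>
  If \<open>norm (p + q) = 1\<close>, then \<open>p + q\<close> and \<open>p - q\<close> form an isosceles orthogonal pair of unit
  vectors whose sum has norm \<open>2 > 1\<close>. By the previous case the square of that norm would be \<open>2\<close>,
  which is absurd.
\<close>

lemma isosceles_unit_pair:
  fixes p q :: "'a::real_normed_vector"
  assumes dich: "rhombus_dichotomy TYPE('a)"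
    and p: "norm p = 1" and q: "norm q = 1"
    and iso: "norm (p + q) = norm (p - q)"
  shows "(norm (p + q))\<^sup>2 = 2"
proof (cases "norm (p + q) > 1")
  case True
  then show ?thesis using isosceles_unit_pair_gt_1[OF dich p q iso] by blast
next
  case False
  have sum: "(p + q) + (p - q) = 2 *\<^sub>R p" and diff: "(p + q) - (p - q) = 2 *\<^sub>R q"
    by (simp_all add: scaleR_2)
  have "norm ((p + q) + (p - q)) \<le> norm (p + q) + norm (p - q)" by (rule norm_triangle_ineq)
  then have "norm (p + q) = 1" using False p iso unfolding sum by simp
  then have "(norm ((p + q) + (p - q)))\<^sup>2 = 2"
    using p q iso by (intro isosceles_unit_pair_gt_1[OF dich]) (auto simp: sum diff)
  then show ?thesis using p unfolding sum by simp
qed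

lemma unit_rhombus_law_if_dichotomy:
  assumes dich: "rhombus_dichotomy TYPE('a::real_normed_vector)"
  shows "unit_rhombus_law TYPE('a)"
  unfolding unit_rhombus_law_def
proof (intro allI impI)
  fix x y :: 'a
  assume x: "norm x = 1" and y: "norm y = 1"
  show "(norm (x + y))\<^sup>2 + (norm (x - y))\<^sup>2 = 4"
  proof (cases "norm (x + y) = norm (x - y)")
    case True
    then have "(norm (x + y))\<^sup>2 = 2" by (rule isosceles_unit_pair[OF dich x y])
    then show ?thesis using True by simp
  next
    case False
    then show ?thesis
      using dich[unfolded rhombus_dichotomy_def, rule_format, of x y] x y by simp
  qed
qed

section \<open>The rhombus law makes every plane Euclidean\<close>

text \<open>
  Rotate a unit vector in the plane of \<open>x\<close> and \<open>y\<close> from \<open>x\<close> to \<open>-x\<close>: at some moment its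
  distances from \<open>x\<close> and \<open>-x\<close> agree.
\<close>

lemma isosceles_partner:
  fixes x y :: "'a::real_normed_vector"
  assumes x: "norm x = 1" and indep: "\<And>c. y \<noteq> c *\<^sub>R x"
  shows "\<exists>v a b. norm v = 1 \<and> norm (x + v) = norm (x - v) \<and> y = a *\<^sub>R x + b *\<^sub>R v"
proof -
  define w where "w t = cos t *\<^sub>R x + sin t *\<^sub>R y" for t
  have w0: "w t \<noteq> 0" for t
  proof
    assume 0: "w t = 0"
    show False
    proof (cases "sin t = 0")
      case True
      then have cos: "cos t = 1 \<or> cos t = - 1"
        using sin_cos_squared_add[of t] by (simp add: power2_eq_1_iff)
      then show False using 0 True x by (auto simp: w_def)
    next
      case False
      have "sin t *\<^sub>R y = (- cos t) *\<^sub>R x"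
        using 0 by (simp add: w_def add_eq_0_iff)
      then have "(1 / sin t) *\<^sub>R (sin t *\<^sub>R y) = (1 / sin t) *\<^sub>R ((- cos t) *\<^sub>R x)" by (rule arg_cong)
      then have "y = (- cos t / sin t) *\<^sub>R x" using False by simp
      then show False using indep by blast
    qed
  qed
  define v where "v t = w t /\<^sub>R norm (w t)" for t
  define f where "f t = norm (x - v t) - norm (x + v t)" for t
  have "\<exists>t. 0 \<le> t \<and> t \<le> pi \<and> f t = 0"
  proof (rule IVT')
    show "f 0 \<le> 0" "0 \<le> f pi" using x by (simp_all add: f_def v_def w_def)
    show "continuous_on {0..pi} f"
      unfolding f_def v_def w_def using w0[unfolded w_def] by (intro continuous_intros) auto
  qed auto
  then obtain t where t: "f t = 0" by blast
  have unit: "norm (v t) = 1" using w0[of t] by (simp add: v_def)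
  have "sin t \<noteq> 0"
  proof
    assume 0: "sin t = 0"
    then have cos: "cos t = 1 \<or> cos t = - 1"
        using sin_cos_squared_add[of t] by (simp add: power2_eq_1_iff)
    then have "v t = x \<or> v t = - x" using 0 x by (auto simp: v_def w_def)
    moreover have "norm (x + x) = 2" using x by (simp flip: scaleR_2)
    ultimately show False using t by (auto simp: f_def)
  qed
  have "w t = norm (w t) *\<^sub>R v t" using w0[of t] by (simp add: v_def)
  then have "sin t *\<^sub>R y = norm (w t) *\<^sub>R v t - cos t *\<^sub>R x"
    by (simp add: w_def algebra_simps)
  then have "(1 / sin t) *\<^sub>R (sin t *\<^sub>R y) = (1 / sin t) *\<^sub>R (norm (w t) *\<^sub>R v t - cos t *\<^sub>R x)"
    by simp
  then have "y = (- cos t / sin t) *\<^sub>R x + (norm (w t) / sin t) *\<^sub>R v t"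
    using \<open>sin t \<noteq> 0\<close> by (simp add: scaleR_diff_right)
  then show ?thesis using unit t unfolding f_def
    by (intro exI[of _ "v t"] exI[of _ "- cos t / sin t"] exI[of _ "norm (w t) / sin t"]) simp
qed

definition ellipse_point :: "'a::real_vector \<Rightarrow> 'a \<Rightarrow> real \<Rightarrow> 'a" where
  "ellipse_point x v t = cos t *\<^sub>R x + sin t *\<^sub>R v"

text \<open>
  The sum and the difference of two points of the ellipse lie in the direction of the bisector and in
  the direction conjugate to it, which is perpendicular to it when \<open>x, v\<close> are regarded as orthonormal.
\<close>

lemma ellipse_point_sum:
  "ellipse_point x v (m + h) + ellipse_point x v (m - h) = (2 * cos h) *\<^sub>R ellipse_point x v m"
  unfolding mult_2 scaleR_add_left
  by (simp add: ellipse_point_def cos_add cos_diff sin_add sin_diff algebra_simps)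

lemma ellipse_point_diff:
  "ellipse_point x v (m + h) - ellipse_point x v (m - h)
     = (2 * sin h) *\<^sub>R ellipse_point x v (m + pi / 2)"
  unfolding mult_2 scaleR_add_left
  by (simp add: ellipse_point_def cos_add cos_diff sin_add sin_diff algebra_simps)

lemma ellipse_point_plus_pi: "ellipse_point x v (t + pi) = - ellipse_point x v t"
  by (simp add: ellipse_point_def)

text \<open>
  Let \<open>A\<close> and \<open>C\<close> be the squared norms of the points at angles \<open>m\<close> and \<open>m + pi/2\<close>. The rhombus
  law for the points at \<open>m - h\<close> and \<open>m + h\<close> gives \<open>cos\<^sup>2 h A + sin\<^sup>2 h C = 1\<close>; for the two points
  a quarter turn further it gives the same equation with \<open>A\<close> and \<open>C\<close> exchanged. The determinant
  \<open>cos\<^sup>4 h - sin\<^sup>4 h = cos (2h)\<close> does not vanish, so \<open>A = C = 1\<close>.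
\<close>

lemma contact_bisection:
  fixes x v :: "'a::real_normed_vector"
  assumes rhombus: "unit_rhombus_law TYPE('a)"
    and "norm (ellipse_point x v (m - h)) = 1" "norm (ellipse_point x v (m + h)) = 1"
    and "norm (ellipse_point x v (m + pi / 2 - h)) = 1"
      "norm (ellipse_point x v (m + pi / 2 + h)) = 1"
    and h: "cos (2 * h) \<noteq> 0"
  shows "norm (ellipse_point x v m) = 1"
proof -
  define A where "A = (norm (ellipse_point x v m))\<^sup>2"
  define C where "C = (norm (ellipse_point x v (m + pi / 2)))\<^sup>2"
  define a where "a = (cos h)\<^sup>2"
  define b where "b = (sin h)\<^sup>2"
  have 1: "a * A + b * C = 1"
    using rhombus[unfolded unit_rhombus_law_def, rule_format, OF assms(3,2)]
    unfolding ellipse_point_sum ellipse_point_diff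
    by (simp add: A_def C_def a_def b_def power_mult_distrib)
  have "m + pi / 2 + pi / 2 = m + pi" by simp
  then have 2: "a * C + b * A = 1"
    using rhombus[unfolded unit_rhombus_law_def, rule_format, OF assms(5,4)]
    unfolding ellipse_point_sum ellipse_point_diff
    by (simp only: ellipse_point_plus_pi)
       (simp add: A_def C_def a_def b_def power_mult_distrib)
  have ab: "a + b = 1" by (simp add: a_def b_def)
  have "a - b \<noteq> 0" using h by (simp add: cos_double a_def b_def)
  moreover have "(a - b) * (A - 1) = 0"
  proof -
    have "(a - b) * (A - 1) = (a + b) * ((a - b) * (A - 1))" using ab by simp
    also have "\<dots> = a * (a * A + b * C) - b * (a * C + b * A) - (a + b) * (a - b)"
      by (simp add: algebra_simps)
    also have "\<dots> = 0" using 1 2 ab by simp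
    finally show ?thesis .
  qed
  ultimately have "A = 1" by simp
  then show ?thesis by (simp add: A_def power2_eq_1_iff) (smt (verit) norm_ge_zero)
qed

text \<open>
  At step zero, the multiples of \<open>pi/4\<close>, the system of the bisection lemma is singular; there the
  isosceles condition takes its place and the rhombus law gives \<open>norm (x + v) = sqrt 2\<close>.
\<close>

lemma contact_dyadic:
  fixes x v :: "'a::real_normed_vector"
  assumes rhombus: "unit_rhombus_law TYPE('a)"
    and x: "norm x = 1" and v: "norm v = 1" and iso: "norm (x + v) = norm (x - v)"
  shows "norm (ellipse_point x v (real k * pi / (4 * 2 ^ n))) = 1"
proof (induction n arbitrary: k)
  case 0
  have sq: "(norm (x + v))\<^sup>2 = 2"
    using rhombus[unfolded unit_rhombus_law_def, rule_format, OF x v] iso by simp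
  then have n2: "norm (x + v) = sqrt 2" "norm (x - v) = sqrt 2"
    using iso by (simp_all add: real_sqrt_unique)
  have p0: "norm (ellipse_point x v 0) = 1" using x by (simp add: ellipse_point_def)
  have p1: "norm (ellipse_point x v (pi / 4)) = 1"
  proof -
    have "ellipse_point x v (pi / 4) = (sqrt 2 / 2) *\<^sub>R (x + v)"
      by (simp add: ellipse_point_def cos_45 sin_45 scaleR_add_right)
    then show ?thesis using n2 by simp
  qed
  have p2: "norm (ellipse_point x v (pi / 2)) = 1" using v by (simp add: ellipse_point_def)
  have p3: "norm (ellipse_point x v (3 * pi / 4)) = 1"
  proof -
    have "3 * pi / 4 = pi / 2 + pi / 4" by simp
    then have "ellipse_point x v (3 * pi / 4) = (- (sqrt 2 / 2)) *\<^sub>R (x - v)"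
      by (simp only: ellipse_point_def cos_add sin_add)
         (simp add: cos_45 sin_45 scaleR_diff_right)
    then show ?thesis using n2 by simp
  qed
  have "norm (ellipse_point x v (real k * pi / 4)) = 1"
  proof (induction k rule: less_induct)
    case (less k)
    show ?case
    proof (cases "k < 4")
      case True
      then have "k = 0 \<or> k = 1 \<or> k = 2 \<or> k = 3" by auto
      then show ?thesis using p0 p1 p2 p3 by auto
    next
      case False
      then have shift: "real k * pi / 4 = real (k - 4) * pi / 4 + pi"
        by (simp add: of_nat_diff field_simps)
      show ?thesis
        unfolding shift ellipse_point_plus_pi norm_minus_cancel using less[of "k - 4"] False by simp
    qed
  qed
  then show ?case by simp
next
  case (Suc n)
  show ?case
  proof (cases "even k")
    case True
    then obtain j where "k = 2 * j" by blast
    then show ?thesis using Suc[of j] by (simp add: field_simps)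
  next
    case False
    then obtain j where k: "k = 2 * j + 1" using oddE by blast
    define h where "h = pi / (4 * 2 ^ Suc n)"
    define m where "m = real k * pi / (4 * 2 ^ Suc n)"
    \<comment> \<open>The shift by a quarter turn adds \<open>2 * 2 ^ n\<close> to the index, so it preserves the dyadic grid.\<close>
    have eqs: "m - h = real j * pi / (4 * 2 ^ n)" "m + h = real (j + 1) * pi / (4 * 2 ^ n)"
      "m + pi / 2 - h = real (j + 2 * 2 ^ n) * pi / (4 * 2 ^ n)"
      "m + pi / 2 + h = real (j + 1 + 2 * 2 ^ n) * pi / (4 * 2 ^ n)"
      by (simp_all add: m_def h_def k field_simps)
    have "cos (2 * h) \<noteq> 0"
    proof -
      have "0 < 2 * h" "2 * h \<le> pi / 4" by (simp_all add: h_def field_simps)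
      then show ?thesis using cos_gt_zero[of "2 * h"] pi_gt_zero by simp
    qed
    then have "norm (ellipse_point x v m) = 1"
      by (rule contact_bisection[OF rhombus, rotated 4]) (simp_all only: eqs Suc)
    then show ?thesis by (simp only: m_def)
  qed
qed

lemma contact_everywhere:
  fixes x v :: "'a::real_normed_vector"
  assumes rhombus: "unit_rhombus_law TYPE('a)"
    and x: "norm x = 1" and v: "norm v = 1" and iso: "norm (x + v) = norm (x - v)"
    and t: "t \<ge> 0"
  shows "norm (ellipse_point x v t) = 1"
proof -
  define \<tau> where "\<tau> n = real (nat \<lfloor>t * (4 * 2 ^ n) / pi\<rfloor>) * pi / (4 * 2 ^ n)" for n :: nat
  have \<tau>: "\<bar>\<tau> n - t\<bar> \<le> (pi / 4) * (1 / 2) ^ n" for n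
  proof -
    define r where "r = t * (4 * 2 ^ n) / pi"
    have "r \<ge> 0" using t by (simp add: r_def)
    then have "\<bar>real (nat \<lfloor>r\<rfloor>) - r\<bar> \<le> 1" by linarith
    moreover have "\<tau> n - t = (real (nat \<lfloor>r\<rfloor>) - r) * (pi / (4 * 2 ^ n))"
      by (simp add: \<tau>_def r_def field_simps)
    ultimately have "\<bar>\<tau> n - t\<bar> \<le> 1 * (pi / (4 * 2 ^ n))"
      by (simp only: abs_mult) (intro mult_mono, auto)
    then show ?thesis by (simp add: power_one_over field_simps)
  qed
  have "(\<lambda>n. (pi / 4) * (1 / 2) ^ n) \<longlonglongrightarrow> (pi / 4) * 0"
    by (intro tendsto_intros LIMSEQ_power_zero) simp
  then have "(\<lambda>n. (pi / 4) * (1 / 2) ^ n) \<longlonglongrightarrow> 0" by simp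
  then have "(\<lambda>n. \<tau> n - t) \<longlonglongrightarrow> 0"
    by (rule Lim_null_comparison[rotated]) (use \<tau> in simp)
  then have "\<tau> \<longlonglongrightarrow> t" by (simp add: LIM_zero_iff)
  then have "(\<lambda>n. norm (ellipse_point x v (\<tau> n))) \<longlonglongrightarrow> norm (ellipse_point x v t)"
    unfolding ellipse_point_def by (intro tendsto_intros)
  moreover have "norm (ellipse_point x v (\<tau> n)) = 1" for n
    unfolding \<tau>_def using contact_dyadic[OF rhombus x v iso] by blast
  ultimately show ?thesis by (simp add: LIMSEQ_const_iff)
qed

lemma isosceles_pair_orthonormal:
  fixes x v :: "'a::real_normed_vector"
  assumes rhombus: "unit_rhombus_law TYPE('a)"
    and x: "norm x = 1" and v: "norm v = 1" and iso: "norm (x + v) = norm (x - v)"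
  shows "(norm (a *\<^sub>R x + b *\<^sub>R v))\<^sup>2 = a\<^sup>2 + b\<^sup>2"
proof (cases "a = 0 \<and> b = 0")
  case False
  define r where "r = sqrt (a\<^sup>2 + b\<^sup>2)"
  have r2: "r\<^sup>2 = a\<^sup>2 + b\<^sup>2" by (simp add: r_def)
  have r: "r > 0" using False by (auto simp: r_def sum_power2_gt_zero_iff)
  have "(a / r)\<^sup>2 + (b / r)\<^sup>2 = (a\<^sup>2 + b\<^sup>2) / r\<^sup>2"
    by (simp add: power_divide add_divide_distrib)
  also have "\<dots> = 1" using r by (simp flip: r2)
  finally have "(a / r)\<^sup>2 + (b / r)\<^sup>2 = 1" .
  then obtain t where "0 \<le> t" and t: "a / r = cos t" "b / r = sin t" by (rule sincos_total_2pi)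
  then have "norm (ellipse_point x v t) = 1" by (intro contact_everywhere[OF rhombus x v iso])
  moreover have "a *\<^sub>R x + b *\<^sub>R v = r *\<^sub>R ellipse_point x v t"
    using r by (simp add: ellipse_point_def scaleR_add_right flip: t)
  ultimately have "norm (a *\<^sub>R x + b *\<^sub>R v) = r" using r by simp
  then show ?thesis by (simp only: r2)
qed simp

text \<open>
  A plane has a basis in which the squared norm is a sum of two squares; this form of the statement
  also covers linearly dependent \<open>x\<close> and \<open>y\<close>.
\<close>

lemma plane_quadratic_form:
  fixes x y :: "'a::real_normed_vector"
  assumes rhombus: "unit_rhombus_law TYPE('a)"
  shows "\<exists>\<kappa> \<mu> \<nu>. \<forall>a b. (norm (a *\<^sub>R x + b *\<^sub>R y))\<^sup>2 = \<kappa> * a\<^sup>2 + \<mu> * a * b + \<nu> * b\<^sup>2"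
proof (cases "x = 0")
  case True
  then have "\<forall>a b. (norm (a *\<^sub>R x + b *\<^sub>R y))\<^sup>2 = 0 * a\<^sup>2 + 0 * a * b + (norm y)\<^sup>2 * b\<^sup>2"
    by (simp add: power_mult_distrib)
  then show ?thesis by blast
next
  case False
  define n where "n = norm x"
  define e where "e = x /\<^sub>R n"
  have n: "n > 0" using False by (simp add: n_def)
  have e: "norm e = 1" and xe: "x = n *\<^sub>R e" using n by (simp_all add: e_def) (simp add: n_def)
  show ?thesis
  proof (cases "\<exists>c. y = c *\<^sub>R e")
    case True
    then obtain c where y: "y = c *\<^sub>R e" by blast
    have "(norm (a *\<^sub>R x + b *\<^sub>R y))\<^sup>2 = n\<^sup>2 * a\<^sup>2 + (2 * n * c) * a * b + c\<^sup>2 * b\<^sup>2" for a b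
    proof -
      have "a *\<^sub>R x + b *\<^sub>R y = (a * n + b * c) *\<^sub>R e" by (simp add: xe y scaleR_add_left)
      then have "(norm (a *\<^sub>R x + b *\<^sub>R y))\<^sup>2 = (a * n + b * c)\<^sup>2" using e by simp
      then show ?thesis by (simp add: power2_eq_square algebra_simps)
    qed
    then show ?thesis by blast
  next
    case False
    then obtain v c d where v: "norm v = 1" "norm (e + v) = norm (e - v)"
      and y: "y = c *\<^sub>R e + d *\<^sub>R v"
      using isosceles_partner[OF e, of y] by blast
    have "(norm (a *\<^sub>R x + b *\<^sub>R y))\<^sup>2 = n\<^sup>2 * a\<^sup>2 + (2 * n * c) * a * b + (c\<^sup>2 + d\<^sup>2) * b\<^sup>2" for a b
    proof -
      have "a *\<^sub>R x + b *\<^sub>R y = (a * n + b * c) *\<^sub>R e + (b * d) *\<^sub>R v"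
        by (simp add: xe y algebra_simps)
      then have "(norm (a *\<^sub>R x + b *\<^sub>R y))\<^sup>2 = (a * n + b * c)\<^sup>2 + (b * d)\<^sup>2"
        by (simp only: isosceles_pair_orthonormal[OF rhombus e v])
      then show ?thesis by (simp add: power2_eq_square algebra_simps)
    qed
    then show ?thesis by blast
  qed
qed

section \<open>The inner product\<close>

text \<open>
  This is the Jordan-von Neumann argument. The quadratic form on the plane of \<open>x\<close> and \<open>y\<close> gives
  the parallelogram law, hence the additivity of the polarized form, and also its homogeneity for
  all real scalars at once.
\<close>

lemma IPspace_if_plane_quadratic_form:
  assumes quad: "\<And>x y :: 'a::real_normed_vector.
      \<exists>\<kappa> \<mu> \<nu>. \<forall>a b. (norm (a *\<^sub>R x + b *\<^sub>R y))\<^sup>2 = \<kappa> * a\<^sup>2 + \<mu> * a * b + \<nu> * b\<^sup>2"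
  shows "IPspace TYPE('a)"
proof -
  define B :: "'a \<Rightarrow> 'a \<Rightarrow> real"
    where "B x y = ((norm (x + y))\<^sup>2 - (norm (x - y))\<^sup>2) / 4" for x y
  have para: "(norm (x + y))\<^sup>2 + (norm (x - y))\<^sup>2 = 2 * (norm x)\<^sup>2 + 2 * (norm y)\<^sup>2" for x y :: 'a
  proof -
    obtain \<kappa> \<mu> \<nu> where Q: "\<And>a b. (norm (a *\<^sub>R x + b *\<^sub>R y))\<^sup>2 = \<kappa> * a\<^sup>2 + \<mu> * a * b + \<nu> * b\<^sup>2"
      using quad[of x y] by blast
    show ?thesis using Q[of 1 1] Q[of 1 "-1"] Q[of 1 0] Q[of 0 1] by simp
  qed
  have sym: "B x y = B y x" for x y
    by (simp add: B_def add.commute norm_minus_commute)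
  have scale: "B (c *\<^sub>R x) y = c * B x y" for c x y
  proof -
    obtain \<kappa> \<mu> \<nu> where Q: "\<And>a b. (norm (a *\<^sub>R x + b *\<^sub>R y))\<^sup>2 = \<kappa> * a\<^sup>2 + \<mu> * a * b + \<nu> * b\<^sup>2"
      using quad[of x y] by blast
    have "B (c *\<^sub>R x) y = \<mu> * c / 2" using Q[of c 1] Q[of c "-1"] by (simp add: B_def)
    moreover have "B x y = \<mu> / 2" using Q[of 1 1] Q[of 1 "-1"] by (simp add: B_def)
    ultimately show ?thesis by (metis mult.commute times_divide_eq_right)
  qed
  have add: "B (x + z) y = B x y + B z y" for x y z
  proof -
    have eqs: "(x + y) + (z + y) = (x + z) + 2 *\<^sub>R y" "(x + y) - (z + y) = x - z"
      "(x - y) + (z - y) = (x + z) - 2 *\<^sub>R y" "(x - y) - (z - y) = x - z"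
      by (simp_all add: scaleR_2)
    \<comment> \<open>The two parallelograms share the diagonal \<open>x - z\<close>, which cancels in the difference.\<close>
    have "4 * (B x y + B z y) = 2 * B (x + z) (2 *\<^sub>R y)"
      using para[of "x + y" "z + y"] para[of "x - y" "z - y"] unfolding eqs
      by (simp add: B_def field_simps)
    also have "B (x + z) (2 *\<^sub>R y) = 2 * B (x + z) y"
      unfolding sym[of "x + z"] by (rule scale)
    finally show ?thesis by simp
  qed
  have diag: "B x x = (norm x)\<^sup>2" for x
    by (simp add: B_def power_mult_distrib flip: scaleR_2)
  have "is_inner_product B"
    unfolding is_inner_product_def bilinear_def
  proof (intro conjI allI impI)
    have lin: "linear (\<lambda>x. B x y)" for y by (rule linearI) (simp_all add: add scale)
    then show "linear (\<lambda>x. B x y)" for y .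
    have swap: "B x = (\<lambda>y. B y x)" for x by (intro ext) (rule sym)
    show "linear (B x)" for x by (subst swap) (rule lin)
    show "B x y = B y x" for x y by (rule sym)
  qed (simp add: diag)
  moreover have "norm x = sqrt (B x x)" for x by (simp add: diag)
  ultimately show ?thesis unfolding IPspace_def by blast
qed

theorem theorem2:
  shows "IPspace TYPE('a::real_normed_vector) \<longleftrightarrow> (\<forall>\<rho>::real. has_angle \<rho> TYPE('a))"
proof
  assume "IPspace TYPE('a)"
  then show "\<forall>\<rho>. has_angle \<rho> TYPE('a)" using IPspace_has_angle by blast
next
  assume "\<forall>\<rho>. has_angle \<rho> TYPE('a)"
  then have "unit_rhombus_law TYPE('a)"
    by (intro unit_rhombus_law_if_dichotomy all_angles_rhombus_dichotomy) simp
  then show "IPspace TYPE('a)"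
    by (intro IPspace_if_plane_quadratic_form plane_quadratic_form)
qed

end
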